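(* For any signature $S$, the binary relation $\to$ on $T(S)$ is exactly the covering relation of the poset $(T(S),\preceq)$ (the $S$-easterly wind poset); that is, $t_1\to t_2$ holds if and only if $t_1\prec t_2$ and there is no $t_3$ with $t_1\prec t_3\prec t_2$.
   Context: A signature is a set $S$ with an arity map $|\cdot|:S\to\mathbb N$. An $S$-term is either the leaf $\ell$ or a tuple $s\,t_1\cdots t_{|s|}$ with $s\in S$ and $t_1,\dots,t_{|s|}$ $S$-terms (an ordered rooted tree whose internal nodes having $k$ children are decorated by elements of arity $k$); $T(S)$ is the set of $S$-terms. The preorder traversal of $s\,t_1\cdots t_k$ visits the root, then $t_1,\dots,t_k$ from left to right recursively. The internal nodes of an $S$-term $t$ are numbered $1,\dots,\deg t$ in preorder ($\deg t$ is the number of internal nodes) and identified with these numbers; $\mathrm{dc}(t)$ is the word of decorations of the internal nodes $1,\dots,\deg t$. The children of a node (leaves included) are numbered $1,2,\dots$ from left to right. An edge of $t$ is a triple $(i_1,j,i_2)$ of internal nodes with $i_2$ the $j$-th child of $i_1$; by convention, when $\deg t\ge 1$, $(1,0,1)$ is also an edge. Each internal node $i$ has a unique edge of the form $(i_1,j,i)$, its parent edge, and we write $\mathrm{pa}(i)=i_1$, $\mathrm{lp}(i)=j$. The connection word $\mathrm{cnc}(t)$ is the word of length $\deg t$ over $\mathbb Q$ with $\mathrm{cnc}(t)(i)=\mathrm{pa}(i)+1-2^{\mathrm{lp}(i)-a}$, where $a$ is the arity of the decoration of $\mathrm{pa}(i)$. The $S$-easterly wind order: $t_1\preceq t_2$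 iff $\mathrm{dc}(t_1)=\mathrm{dc}(t_2)$ and $\mathrm{cnc}(t_1)(i)\le\mathrm{cnc}(t_2)(i)$ for all internal nodes $i$. For $i\ge 1$, $t_1\to_i t_2$ holds when $t_1$ has degree at least $i$, the internal node $i$ of $t_1$ is visited immediately after some leaf $x$ in the preorder traversal of $t_1$, and $t_2$ is obtained from $t_1$ by detaching the subterm rooted at $i$ (a leaf taking its place) and grafting it in place of the leaf $x$. The relation $\to$ is the union of all $\to_i$, $i\ge1$. *)

theory Defs
  imports Complex_Main
begin

text \<open>A signature is a set \<open>S\<close> of symbols together with an arity map \<open>ar\<close>. Terms are first
  introduced without any constraint on the number of children; \<open>terms S ar\<close> is the set of
  \<open>S\<close>-terms.\<close>

datatype 's trm = Leaf | Node (root_dec: 's) (children: "'s trm list")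

inductive_set terms :: "'s set \<Rightarrow> ('s \<Rightarrow> nat) \<Rightarrow> 's trm set"
  for S :: "'s set" and ar :: "'s \<Rightarrow> nat" where
  Leaf: "Leaf \<in> terms S ar"
| Node: "s \<in> S \<Longrightarrow> length ts = ar s \<Longrightarrow> (\<forall>t\<in>set ts. t \<in> terms S ar) \<Longrightarrow> Node s ts \<in> terms S ar"

text \<open>Nodes (leaves included) are addressed by the list of child numbers on the path from the
  root; children are numbered from 1. \<open>subterm_at\<close> and \<open>replace_at\<close> are only meaningful on the
  addresses listed by \<open>preorder\<close>.\<close>

fun subterm_at :: "'s trm \<Rightarrow> nat list \<Rightarrow> 's trm" where
  "subterm_at t [] = t"
| "subterm_at (Node s ts) (j # p) = subterm_at (ts ! (j - 1)) p"
| "subterm_at Leaf (j # p) = Leaf"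

fun replace_at :: "'s trm \<Rightarrow> nat list \<Rightarrow> 's trm \<Rightarrow> 's trm" where
  "replace_at t [] u = u"
| "replace_at (Node s ts) (j # p) u = Node s (ts[j - 1 := replace_at (ts ! (j - 1)) p u])"
| "replace_at Leaf (j # p) u = Leaf"

primrec preorder :: "'s trm \<Rightarrow> nat list list" where
  "preorder Leaf = [[]]"
| "preorder (Node s ts) =
     [] # concat (map (\<lambda>(j, ps). map ((#) j) ps)
                      (zip [1..<Suc (length ts)] (map preorder ts)))"

definition internal_nodes :: "'s trm \<Rightarrow> nat list list" where
  "internal_nodes t = filter (\<lambda>p. subterm_at t p \<noteq> Leaf) (preorder t)"

definition deg :: "'s trm \<Rightarrow> nat" where
  "deg t = length (internal_nodes t)"

text \<open>The address of the internal node with number \<open>i \<in> {1..deg t}\<close>.\<close>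

definition node :: "'s trm \<Rightarrow> nat \<Rightarrow> nat list" where
  "node t i = internal_nodes t ! (i - 1)"

definition dc :: "'s trm \<Rightarrow> 's list" where
  "dc t = map (\<lambda>p. root_dec (subterm_at t p)) (internal_nodes t)"

definition edges :: "'s trm \<Rightarrow> (nat \<times> nat \<times> nat) set" where
  "edges t =
     {(i1, j, i2). i1 \<in> {1..deg t} \<and> i2 \<in> {1..deg t} \<and> node t i2 = node t i1 @ [j]} \<union>
     (if deg t \<ge> 1 then {(1, 0, 1)} else {})"

definition pa :: "'s trm \<Rightarrow> nat \<Rightarrow> nat" where
  "pa t i = (THE i1. \<exists>j. (i1, j, i) \<in> edges t)"

definition lp :: "'s trm \<Rightarrow> nat \<Rightarrow> nat" where
  "lp t i = (THE j. \<exists>i1. (i1, j, i) \<in> edges t)"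

text \<open>Words are lists, so the \<open>i\<close>-th letter of a word \<open>w\<close> is \<open>w ! (i - 1)\<close>. The exponent in the
  connection word is at most 0, hence the integer power.\<close>

definition cnc :: "('s \<Rightarrow> nat) \<Rightarrow> 's trm \<Rightarrow> rat list" where
  "cnc ar t =
     map (\<lambda>i. of_nat (pa t i) + 1
              - 2 powi (int (lp t i) - int (ar (dc t ! (pa t i - 1)))))
         [1..<Suc (deg t)]"

definition wind_le :: "('s \<Rightarrow> nat) \<Rightarrow> 's trm \<Rightarrow> 's trm \<Rightarrow> bool" where
  "wind_le ar t1 t2 \<longleftrightarrow>
     dc t1 = dc t2 \<and> (\<forall>i\<in>{1..deg t1}. cnc ar t1 ! (i - 1) \<le> cnc ar t2 ! (i - 1))"

definition wind_less :: "('s \<Rightarrow> nat) \<Rightarrow> 's trm \<Rightarrow> 's trm \<Rightarrow> bool" where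
  "wind_less ar t1 t2 \<longleftrightarrow> wind_le ar t1 t2 \<and> t1 \<noteq> t2"

text \<open>In \<open>wind_step_at\<close>, \<open>preorder t1 ! k\<close> is the address of the leaf visited immediately before the
  internal node \<open>i\<close>. This leaf and the node \<open>i\<close> are at incomparable addresses, so the order of the
  two replacements is irrelevant.\<close>

definition wind_step_at :: "nat \<Rightarrow> 's trm \<Rightarrow> 's trm \<Rightarrow> bool" where
  "wind_step_at i t1 t2 \<longleftrightarrow>
     i \<le> deg t1 \<and>
     (\<exists>k. Suc k < length (preorder t1) \<and>
          preorder t1 ! Suc k = node t1 i \<and>
          subterm_at t1 (preorder t1 ! k) = Leaf \<and>
          t2 = replace_at (replace_at t1 (node t1 i) Leaf)
                          (preorder t1 ! k) (subterm_at t1 (node t1 i)))"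

definition wind_step :: "'s trm \<Rightarrow> 's trm \<Rightarrow> bool" where
  "wind_step t1 t2 \<longleftrightarrow> (\<exists>i\<ge>1. wind_step_at i t1 t2)"

end

theory Submission imports Defs begin

text \<open>Read a term as its preorder word, with one letter per leaf or internal node, and process this
  word with a stack of open slots (positions still to be filled): every letter pops the top slot,
  and an internal node then pushes the slots of its children. Labelling the slots by their
  connection values, the stack is strictly decreasing from the top, and the connection word lists
  the slots popped by internal nodes. A leaf letter thus lowers the slot available to the next
  internal node. A wind step moves a leaf letter from just before the word of a subterm to just
  after it; this changes a single entry of the connection word, to the next higher slot on the
  stack, so nothing fits in between. Conversely, if \<open>t\<^sub>1 \<prec> t\<^sub>2\<close>, then at the first node where
  the connection words differ the stacks agree, so \<open>t\<^sub>1\<close> has a leaf just before that node, and the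
  corresponding step leads to a term below \<open>t\<^sub>2\<close>.\<close>

section \<open>Preorder words and their unique decoding\<close>

fun code :: "'s trm \<Rightarrow> 's option list" where
  "code Leaf = [None]"
| "code (Node s ts) = Some s # concat (map code ts)"

definition syms :: "'s option list \<Rightarrow> 's list" where
  "syms w = map the (filter (\<lambda>x. x \<noteq> None) w)"

lemma syms_simps [simp]:
  "syms [] = []" "syms (None # w) = syms w" "syms (Some s # w) = s # syms w"
  "syms (u @ w) = syms u @ syms w"
  by (simp_all add: syms_def)

text \<open>The Lukasiewicz condition: \<open>n\<close> counts the open slots, so the accepted words
  are the concatenations of the preorder words of \<open>n\<close> terms respecting
  \<open>ar\<close>.\<close>

fun valid :: "('s \<Rightarrow> nat) \<Rightarrow> nat \<Rightarrow> 's option list \<Rightarrow> bool" where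
  "valid ar n [] \<longleftrightarrow> n = 0"
| "valid ar 0 (x # w) \<longleftrightarrow> False"
| "valid ar (Suc n) (None # w) \<longleftrightarrow> valid ar n w"
| "valid ar (Suc n) (Some s # w) \<longleftrightarrow> valid ar (ar s + n) w"

lemma valid_0 [simp]: "valid ar 0 w \<longleftrightarrow> w = []"
  by (cases w) auto

lemma valid_append: "valid ar a u \<Longrightarrow> valid ar b w \<Longrightarrow> valid ar (a + b) (u @ w)"
  by (induction ar a u rule: valid.induct) (simp_all add: add.assoc)

lemma valid_concat:
  "\<forall>t\<in>set ts. valid ar 1 (f t) \<Longrightarrow> valid ar (length ts) (concat (map f ts))"
proof (induction ts)
  case (Cons t ts)
  then show ?case using valid_append[of ar 1 "f t" "length ts"] by simp
qed simp

lemma valid_code: "t \<in> terms S ar \<Longrightarrow> valid ar 1 (code t)"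
proof (induction rule: terms.induct)
  case (Node s ts)
  then show ?case using valid_concat[of ts ar code] by simp
qed simp

text \<open>The letters read so far determine the number of open slots, and a valid word ends
  exactly when this number first reaches 0. Two valid words that start alike therefore stop
  together.\<close>

lemma valid_prefix_unique:
  "valid ar n u \<Longrightarrow> valid ar n u' \<Longrightarrow> u @ w = u' @ w' \<Longrightarrow> u = u'"
proof (induction ar n u arbitrary: u' rule: valid.induct)
  case (1 ar n)
  from 1(1,2) show ?case by simp
next
  case (2 ar x u)
  from 2(1) show ?case by simp
next
  case (3 ar n u)
  from 3(3,4) obtain v where v: "u' = None # v" by (cases u') auto
  from 3(3,4) v have "valid ar n v" "u @ w = v @ w'" by simp_all
  from 3(1)[OF _ this] 3(2) v show ?case by simp
next
  case (4 ar n s u)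
  from 4(3,4) obtain v where v: "u' = Some s # v" by (cases u') auto
  from 4(3,4) v have "valid ar (ar s + n) v" "u @ w = v @ w'" by simp_all
  from 4(1)[OF _ this] 4(2) v show ?case by simp
qed

text \<open>Uniqueness of valid prefixes cuts both concatenations at the same places. Injectivity of
  \<open>code\<close> on the members is a hypothesis so that the lemma applies inside the induction
  on terms.\<close>

lemma concat_code_inj:
  assumes "length ts = length us" "concat (map code ts) = concat (map code us)"
    and "\<forall>t\<in>set ts. valid ar 1 (code t)" "\<forall>t\<in>set us. valid ar 1 (code t)"
    and "\<forall>t\<in>set ts. \<forall>u\<in>set us. code t = code u \<longrightarrow> t = u"
  shows "ts = us"
  using assms
proof (induction ts us rule: list_induct2)
  case (Cons t ts u us)
  have c: "code t = code u"
    using valid_prefix_unique[of ar 1 "code t" "code u"] Cons.prems(1-3) by simp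
  moreover have "ts = us"
    using Cons.prems c by (intro Cons.IH) simp_all
  moreover have "t = u"
    using Cons.prems(4) c by (meson list.set_intros(1))
  ultimately show ?case by simp
qed simp

lemma code_inj:
  "t \<in> terms S ar \<Longrightarrow> u \<in> terms S ar \<Longrightarrow> code t = code u \<Longrightarrow> t = u"
proof (induction arbitrary: u rule: terms.induct)
  case Leaf then show ?case by (cases u) auto
next
  case (Node s ts)
  from Node.prems obtain us where u: "u = Node s us" by (cases u) auto
  with Node.prems have us: "length us = ar s" "\<forall>t\<in>set us. t \<in> terms S ar"
    by (auto elim: terms.cases)
  have "ts = us"
  proof (rule concat_code_inj[where ar = ar])
    show "\<forall>t\<in>set ts. \<forall>u\<in>set us. code t = code u \<longrightarrow> t = u"
      using Node.IH us(2) by blast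
    show "\<forall>t\<in>set ts. valid ar 1 (code t)" "\<forall>t\<in>set us. valid ar 1 (code t)"
      using Node.IH us(2) valid_code by blast+
    show "length ts = length us" "concat (map code ts) = concat (map code us)"
      using Node.hyps Node.prems(2) u us(1) by simp_all
  qed
  with u show ?case by simp
qed

section \<open>Runs of the stack machine on words\<close>

text \<open>The stack machine, generic in the labels of the slots: \<open>push m q s\<close> are the slots opened by the
  \<open>m\<close>-th internal node, with decoration \<open>s\<close>, sitting in slot \<open>q\<close>. Slots are labelled by addresses
  to recover \<open>internal_nodes\<close>, and by connection values to recover \<open>cnc\<close>.\<close>

fun trav :: "(nat \<Rightarrow> 'q \<Rightarrow> 's \<Rightarrow> 'q list) \<Rightarrow> 'q list \<Rightarrow> nat \<Rightarrow> 's option list \<Rightarrow> 'q list" where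
  "trav push (q # st) m (None # w) = trav push st m w"
| "trav push (q # st) m (Some s # w) = q # trav push (push m q s @ st) (Suc m) w"
| "trav push st m w = []"

fun stk :: "(nat \<Rightarrow> 'q \<Rightarrow> 's \<Rightarrow> 'q list) \<Rightarrow> 'q list \<Rightarrow> nat \<Rightarrow> 's option list \<Rightarrow> 'q list" where
  "stk push (q # st) m (None # w) = stk push st m w"
| "stk push (q # st) m (Some s # w) = stk push (push m q s @ st) (Suc m) w"
| "stk push st m w = st"

lemma trav_Nil [simp]: "trav push [] m w = []" "trav push st m [] = []"
  by (cases w; simp) (cases st; simp)

lemma stk_Nil [simp]: "stk push [] m w = []" "stk push st m [] = st"
  by (cases w; simp) (cases st; simp)

lemma trav_append:
  "trav push st m (u @ w) =
     trav push st m u @ trav push (stk push st m u) (m + length (syms u)) w"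
  by (induction push st m u rule: trav.induct) (auto simp: add_ac)

text \<open>The stack height and the counter of \<open>valid\<close> evolve alike, since a symbol
  \<open>s\<close> opens \<open>ar s\<close> slots.\<close>

lemma valid_stk:
  assumes "\<And>m q s. length (push m q s) = ar s"
  shows "valid ar (length st) (u @ w) \<Longrightarrow> valid ar (length (stk push st m u)) w"
  using assms by (induction push st m u rule: trav.induct) auto

lemma length_trav:
  assumes "\<And>m q s. length (push m q s) = ar s"
  shows "valid ar (length st) (u @ w) \<Longrightarrow> length (trav push st m u) = length (syms u)"
  using assms by (induction push st m u rule: trav.induct) auto

text \<open>The word \<open>u\<close> consumes exactly \<open>ps\<close> and the slots it opens
  itself, so \<open>st\<close> is first touched by \<open>w\<close>.\<close>

lemma trav_valid_append:
  assumes "\<And>m q s. length (push m q s) = ar s"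
  shows "valid ar (length ps) u \<Longrightarrow>
    trav push (ps @ st) m (u @ w) = trav push ps m u @ trav push st (m + length (syms u)) w"
  using assms
proof (induction push ps m u rule: trav.induct)
  case (2 push q ps m s u)
  then have "trav push ((push m q s @ ps) @ st) (Suc m) (u @ w) =
     trav push (push m q s @ ps) (Suc m) u @ trav push st (Suc m + length (syms u)) w"
    by simp
  then show ?case by simp
qed auto

section \<open>Preorder addresses and positions in the word\<close>

lemma code_Cons: "\<exists>x w. code t = x # w"
  by (cases t) auto

lemma preorder_Node:
  "preorder (Node s ts) =
     [] # concat (map (\<lambda>i. map ((#) (Suc i)) (preorder (ts ! i))) [0..<length ts])"
proof -
  have "map (\<lambda>(j, ps). map ((#) j) ps) (zip [1..<Suc (length ts)] (map preorder ts)) =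
    map (\<lambda>i. map ((#) (Suc i)) (preorder (ts ! i))) [0..<length ts]"
    by (rule nth_equalityI) (auto simp del: upt_Suc)
  then show ?thesis by simp
qed

lemma code_Node: "code (Node s ts) = Some s # concat (map (\<lambda>i. code (ts ! i)) [0..<length ts])"
proof -
  have "map code ts = map (\<lambda>i. code (ts ! i)) [0..<length ts]"
    by (rule nth_equalityI) auto
  then show ?thesis by simp
qed

declare preorder.simps(2) [simp del]

definition letter :: "'s trm \<Rightarrow> 's option" where
  "letter t = (case t of Leaf \<Rightarrow> None | Node s ts \<Rightarrow> Some s)"

lemma letter_simps [simp]: "letter t = None \<longleftrightarrow> t = Leaf" "letter (Node s ts) = Some s"
  by (auto simp: letter_def split: trm.splits)

text \<open>The bridge between addresses and words: equal positions in \<open>code t\<close> and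
  \<open>preorder t\<close> belong to the same node or leaf.\<close>

lemma code_eq_map: "code t = map (\<lambda>p. letter (subterm_at t p)) (preorder t)"
proof (induction t)
  case (Node s ts)
  have "map (\<lambda>i. code (ts ! i)) [0..<length ts] =
    map (\<lambda>i. map (\<lambda>p. letter (subterm_at (ts ! i) p)) (preorder (ts ! i))) [0..<length ts]"
    using Node by (intro map_cong) auto
  then have "concat (map (\<lambda>i. code (ts ! i)) [0..<length ts]) =
    concat (map (\<lambda>i. map (\<lambda>p. letter (subterm_at (ts ! i) p)) (preorder (ts ! i))) [0..<length ts])"
    by (rule arg_cong)
  then show ?case
    unfolding code_Node preorder_Node by (simp add: map_concat comp_def)
qed (simp add: letter_def)

lemma length_preorder [simp]: "length (preorder t) = length (code t)"
  by (simp add: code_eq_map)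

lemma nth_code: "k < length (code t) \<Longrightarrow> code t ! k = letter (subterm_at t (preorder t ! k))"
  using length_preorder[of t] by (metis code_eq_map nth_map)

lemma dc_eq_syms: "dc t = syms (code t)"
proof -
  have "map (\<lambda>p. root_dec (subterm_at t p)) (filter (\<lambda>p. subterm_at t p \<noteq> Leaf) ps) =
    syms (map (\<lambda>p. letter (subterm_at t p)) ps)" for ps
  proof (induction ps)
    case (Cons p ps)
    then show ?case by (cases "subterm_at t p") (simp_all add: letter_def)
  qed simp
  then show ?thesis
    by (simp add: dc_def internal_nodes_def code_eq_map)
qed

lemma deg_eq: "deg t = length (dc t)"
  by (simp add: deg_def dc_def)

lemma distinct_preorder: "distinct (preorder t)"
proof (induction t)
  case (Node s ts)
  let ?f = "\<lambda>i. map ((#) (Suc i)) (preorder (ts ! i))"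
  have ne: "preorder u \<noteq> []" for u :: "'s trm"
    by (cases u) (simp_all add: preorder_Node)
  \<comment> \<open>All addresses in block \<open>i\<close> start with \<open>Suc i\<close>, and
    blocks are nonempty, so their heads separate them.\<close>
  have "inj ?f"
  proof (rule injI)
    fix i k assume "?f i = ?f k"
    then have "hd (?f i) = hd (?f k)" by simp
    then show "i = k" by (simp add: hd_map ne)
  qed
  then have "distinct (concat (map ?f [0..<length ts]))"
    using Node by (intro distinct_concat) (auto simp: distinct_map inj_on_def)
  then show ?case
    unfolding preorder_Node by auto
qed simp

lemma nth_concat_split:
  assumes "k < length (concat xss)"
  obtains i k' where "i < length xss" "k' < length (xss ! i)"
    "k = length (concat (take i xss)) + k'"
  using assms
proof (induction xss arbitrary: k thesis)
  case (Cons xs xss)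
  show ?case
  proof (cases "k < length xs")
    case True
    then show ?thesis using Cons.prems(1)[of 0 k] by simp
  next
    case False
    then have "k - length xs < length (concat xss)" using Cons.prems(2) by simp
    then obtain i k' where "i < length xss" "k' < length (xss ! i)"
      "k - length xs = length (concat (take i xss)) + k'"
      using Cons.IH by blast
    then show ?thesis using Cons.prems(1)[of "Suc i" k'] False by simp
  qed
qed simp

lemma terms_Node_iff:
  "Node s ts \<in> terms S ar \<longleftrightarrow> s \<in> S \<and> length ts = ar s \<and> (\<forall>t\<in>set ts. t \<in> terms S ar)"
  by (auto intro: terms.Node elim: terms.cases)

lemma take_1_preorder [simp]: "take (Suc 0) (preorder t) = [[]]"
  by (cases t) (simp_all add: preorder_Node)

text \<open>A subterm occupies a contiguous factor of the word starting at its own position, so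
  replacing it exchanges that factor alone. The addresses up to position \<open>k\<close> are listed
  before those strictly inside the new subterm; hence a leaf keeps its address when a later node is
  detached.\<close>

lemma code_split:
  fixes t :: "'s trm"
  assumes "k < length (code t)"
  shows "\<exists>z. code t = take k (code t) @ code (subterm_at t (preorder t ! k)) @ z \<and>
    (\<forall>r. code (replace_at t (preorder t ! k) r) = take k (code t) @ code r @ z \<and>
         take (Suc k) (preorder (replace_at t (preorder t ! k) r)) = take (Suc k) (preorder t))"
  using assms
proof (induction t arbitrary: k)
  case (Node s ts)
  show ?case
  proof (cases k)
    case 0
    then show ?thesis by (simp add: preorder_Node)
  next
    case (Suc l)
    define blocks where
      "blocks us = map (\<lambda>i. map ((#) (Suc i)) (preorder (us ! i))) [0..<length us]" for us :: "'s trm list"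
    have pre: "preorder (Node s us) = [] # concat (blocks us)" for us
      by (simp add: preorder_Node blocks_def)
    have len: "length (blocks us) = length us" for us
      by (simp add: blocks_def)
    have nth: "blocks us ! i = map ((#) (Suc i)) (preorder (us ! i))" if "i < length us" for us i
      using that by (simp add: blocks_def)
    have code_len: "length (concat (take i (blocks us))) = length (concat (map code (take i us)))" for us i
    proof -
      have "map length (take i (blocks us)) = map length (map code (take i us))"
        by (rule nth_equalityI) (simp_all add: nth len)
      then show ?thesis unfolding length_concat by simp
    qed
    have "l < length (concat (blocks ts))"
      using Node.prems Suc code_len[of "length ts" ts] by (simp add: len)
    \<comment> \<open>With the root taken off, position \<open>l\<close> falls into the block of
      some child at offset \<open>k'\<close>.\<close>
    then obtain i k' where i: "i < length ts" and k': "k' < length (blocks ts ! i)"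
      and l: "l = length (concat (take i (blocks ts))) + k'"
      by (rule nth_concat_split) (auto simp: len)
    let ?p = "preorder (ts ! i) ! k'"
    have k'2: "k' < length (code (ts ! i))" using k' i by (simp add: nth)
    have split_pre: "preorder (Node s us) =
        [] # concat (take i (blocks us)) @ map ((#) (Suc i)) (preorder (us ! i)) @
             concat (drop (Suc i) (blocks us))" if "i < length us" for us
      using id_take_nth_drop[of i "blocks us"] that
      by (metis concat.simps(2) concat_append len nth pre)
    have split_code: "code (Node s us) =
        Some s # concat (map code (take i us)) @ code (us ! i) @ concat (map code (drop (Suc i) us))"
      if "i < length us" for us
      using arg_cong[OF id_take_nth_drop[OF that], of "\<lambda>x. concat (map code x)"] by simp
    have p: "preorder (Node s ts) ! k = Suc i # ?p"
      using i k'2 by (simp add: split_pre Suc l nth_append)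
    obtain z where z: "code (ts ! i) = take k' (code (ts ! i)) @ code (subterm_at (ts ! i) ?p) @ z"
      and r: "\<And>r. code (replace_at (ts ! i) ?p r) = take k' (code (ts ! i)) @ code r @ z"
      "\<And>r. take (Suc k') (preorder (replace_at (ts ! i) ?p r)) = take (Suc k') (preorder (ts ! i))"
      using Node.IH[OF nth_mem[OF i] k'2] by blast
    let ?Z = "z @ concat (map code (drop (Suc i) ts))"
    have tk: "take k (code (Node s ts)) =
        Some s # concat (map code (take i ts)) @ take k' (code (ts ! i))"
      using k'2 by (simp only: split_code[OF i]) (simp add: Suc l code_len)
    have "code (Node s ts) = take k (code (Node s ts)) @ code (subterm_at (Node s ts) (Suc i # ?p)) @ ?Z"
      unfolding tk using z by (simp only: split_code[OF i]) simp
    moreover have "code (replace_at (Node s ts) (Suc i # ?p) r) = take k (code (Node s ts)) @ code r @ ?Z" for r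
      unfolding tk using i by (simp add: split_code r(1) del: code.simps)
    moreover have "take (Suc k) (preorder (replace_at (Node s ts) (Suc i # ?p) r)) =
        take (Suc k) (preorder (Node s ts))" for r
    proof -
      let ?us = "ts[i := replace_at (ts ! i) ?p r]"
      have iu: "i < length ?us" using i by simp
      have tb: "take i (blocks ?us) = take i (blocks ts)"
        by (rule nth_equalityI) (simp_all add: len nth)
      have "take (Suc k) (preorder (Node s us)) =
          [] # concat (take i (blocks ts)) @ map ((#) (Suc i)) (take (Suc k') (preorder (us ! i)))"
        if "i < length us" "take i (blocks us) = take i (blocks ts)" "k' < length (preorder (us ! i))" for us
        using that by (simp only: split_pre) (simp add: Suc l take_map)
      \<comment> \<open>Since \<open>code r\<close> is nonempty, offset \<open>k'\<close> still
        exists in the modified child.\<close>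
      moreover have "k' < length (preorder (?us ! i))"
        using k'2 r(1)[of r] i code_Cons[of r] by auto
      ultimately show ?thesis
        using i iu tb k'2 r(2)[of r] by simp
    qed
    ultimately show ?thesis unfolding p by blast
  qed
qed simp

lemma subterm_replace_terms:
  fixes t :: "'s trm"
  assumes "t \<in> terms S ar" "p \<in> set (preorder t)"
  shows "subterm_at t p \<in> terms S ar"
    and "r \<in> terms S ar \<Longrightarrow> replace_at t p r \<in> terms S ar"
  using assms
proof (induction t arbitrary: p rule: trm.induct)
  case (Node s ts)
  { case 1 then show ?case using Node by (auto simp: preorder_Node terms_Node_iff)
  next
    case 2 then show ?case using Node
      by (auto simp: preorder_Node terms_Node_iff dest!: set_update_subset_insert[THEN subsetD]) }
qed simp_all

section \<open>Internal nodes and connection words as outputs of the machine\<close>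

definition address_push :: "('s \<Rightarrow> nat) \<Rightarrow> nat \<Rightarrow> nat list \<Rightarrow> 's \<Rightarrow> nat list list" where
  "address_push ar m q s = map (\<lambda>j. q @ [j]) [1..<Suc (ar s)]"

text \<open>\<open>slot ar m s 0\<close> serves as the label of the root, by the convention on the edge \<open>(1, 0, 1)\<close>.\<close>

definition slot :: "('s \<Rightarrow> nat) \<Rightarrow> nat \<Rightarrow> 's \<Rightarrow> nat \<Rightarrow> rat" where
  "slot ar m s j = of_nat m + 1 - 2 powi (int j - int (ar s))"

definition slot_push :: "('s \<Rightarrow> nat) \<Rightarrow> nat \<Rightarrow> rat \<Rightarrow> 's \<Rightarrow> rat list" where
  "slot_push ar m q s = map (slot ar m s) [1..<Suc (ar s)]"

lemma length_push [simp]: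
  "length (address_push ar m p s) = ar s" "length (slot_push ar m q s) = ar s"
  by (simp_all add: address_push_def slot_push_def)

lemma internal_nodes_Node:
  "internal_nodes (Node s ts) =
     [] # concat (map (\<lambda>i. map ((#) (Suc i)) (internal_nodes (ts ! i))) [0..<length ts])"
proof -
  have "filter (\<lambda>p. subterm_at (Node s ts) p \<noteq> Leaf) (map ((#) (Suc i)) ps) =
      map ((#) (Suc i)) (filter (\<lambda>p. subterm_at (ts ! i) p \<noteq> Leaf) ps)" for i ps
    by (simp add: filter_map comp_def)
  then show ?thesis
    by (simp add: internal_nodes_def preorder_Node filter_concat comp_def)
qed

lemma trav_concat_code:
  assumes "length qs = length ts"
    and "\<forall>t\<in>set ts. valid ar 1 (code t) \<and>
          (\<forall>q m. trav (address_push ar) [q] m (code t) = map ((@) q) (internal_nodes t))"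
  shows "trav (address_push ar) qs m (concat (map code ts)) =
    concat (map (\<lambda>i. map ((@) (qs ! i)) (internal_nodes (ts ! i))) [0..<length ts])"
  using assms
proof (induction qs ts arbitrary: m rule: list_induct2)
  case (Cons q qs t ts)
  have "trav (address_push ar) ([q] @ qs) m (code t @ concat (map code ts)) =
    trav (address_push ar) [q] m (code t) @
    trav (address_push ar) qs (m + length (syms (code t))) (concat (map code ts))"
    by (rule trav_valid_append[where ar = ar]) (use Cons.prems in auto)
  also have "\<dots> = map ((@) q) (internal_nodes t) @
     concat (map (\<lambda>i. map ((@) (qs ! i)) (internal_nodes (ts ! i))) [0..<length ts])"
    using Cons by simp
  finally show ?case
    by (simp del: upt_Suc add: upt_conv_Cons map_Suc_upt[symmetric] comp_def)
qed simp

text \<open>A general slot \<open>q\<close> in place of the root address \<open>[]\<close> suits the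
  induction: the children sit in the slots \<open>q @ [Suc i]\<close>.\<close>

lemma trav_code:
  "t \<in> terms S ar \<Longrightarrow>
    trav (address_push ar) [q] m (code t) = map ((@) q) (internal_nodes t)"
proof (induction arbitrary: q m rule: terms.induct)
  case Leaf
  then show ?case by (simp add: internal_nodes_def)
next
  case (Node s ts)
  have "map (\<lambda>i. map ((@) (address_push ar m q s ! i)) (internal_nodes (ts ! i))) [0..<length ts] =
    map (\<lambda>i. map (\<lambda>p. q @ Suc i # p) (internal_nodes (ts ! i))) [0..<length ts]"
    using Node.hyps by (intro map_cong) (auto simp: address_push_def simp del: upt_Suc)
  then have "concat (map (\<lambda>i. map ((@) (address_push ar m q s ! i)) (internal_nodes (ts ! i))) [0..<length ts]) =
    concat (map (\<lambda>i. map (\<lambda>p. q @ Suc i # p) (internal_nodes (ts ! i))) [0..<length ts])"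
    by (rule arg_cong)
  moreover have "trav (address_push ar) (address_push ar m q s) (Suc m) (concat (map code ts)) =
    concat (map (\<lambda>i. map ((@) (address_push ar m q s ! i)) (internal_nodes (ts ! i))) [0..<length ts])"
    using Node valid_code by (intro trav_concat_code) (simp, blast)
  ultimately show ?case
    by (simp add: internal_nodes_Node map_concat comp_def)
qed

text \<open>Matches an address label with a connection label: both describe child \<open>j\<close>
  of node number \<open>p\<close>. \<open>N\<close> and \<open>D\<close> stand for the complete
  lists of nodes and decorations, fixed in advance.\<close>

definition parent_edge :: "('s \<Rightarrow> nat) \<Rightarrow> nat list list \<Rightarrow> 's list \<Rightarrow> nat list \<Rightarrow> rat \<Rightarrow> bool" where
  "parent_edge ar N D a v \<longleftrightarrow> (\<exists>p j. 1 \<le> p \<and> p \<le> length N \<and>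
     a = N ! (p - 1) @ [j] \<and> v = slot ar p (D ! (p - 1)) j)"

text \<open>Both labellings are run in parallel on the same word. \<open>Npre\<close> and
  \<open>Dpre\<close> hold the nodes already read, so the next node has number \<open>m\<close> and
  list index \<open>length Npre\<close>, and the slots it opens are related by construction.\<close>

lemma trav_parent_edge:
  assumes "list_all2 (parent_edge ar N D) ast st" "N = Npre @ trav (address_push ar) ast m w"
    "D = Dpre @ syms w" "length Dpre = length Npre" "m = Suc (length Npre)"
  shows "list_all2 (parent_edge ar N D) (trav (address_push ar) ast m w) (trav (slot_push ar) st m w)"
  using assms
proof (induction w arbitrary: ast st m Npre Dpre)
  case (Cons x w)
  show ?case
  proof (cases ast)
    case Nil
    with Cons show ?thesis by simp
  next
    case (Cons a ast')
    with Cons.prems obtain v st' where st: "st = v # st'" "parent_edge ar N D a v"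
      "list_all2 (parent_edge ar N D) ast' st'" by (auto simp: list_all2_Cons1)
    show ?thesis
    proof (cases x)
      case None
      with st Cons Cons.prems show ?thesis
        using Cons.IH[of ast' st' Npre m Dpre] by simp
    next
      case (Some s)
      have N: "N ! length Npre = a" "length Npre < length N" "D ! length Npre = s"
        using Cons.prems Cons Some by (simp_all add: nth_append)
      have "list_all2 (parent_edge ar N D) (address_push ar m a s) (slot_push ar m v s)"
        using N Cons.prems(5) unfolding address_push_def slot_push_def
        by (auto simp: list_all2_conv_all_nth parent_edge_def simp del: upt_Suc
            intro!: exI[of _ "Suc (length Npre)"])
      then have "list_all2 (parent_edge ar N D) (address_push ar m a s @ ast') (slot_push ar m v s @ st')"
        using st by (intro list_all2_appendI)
      then show ?thesis
        using Cons.IH[of "address_push ar m a s @ ast'" "slot_push ar m v s @ st'" "Npre @ [a]" "Suc m" "Dpre @ [s]"]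
          Cons Some st Cons.prems by simp
    qed
  qed
qed simp

text \<open>The parallel run attaches to each node other than the root the value of its parent edge.
  The root is treated apart, through its conventional edge.\<close>

lemma cnc_eq_trav:
  assumes t: "Node s ts \<in> terms S ar"
  shows "cnc ar (Node s ts) = trav (slot_push ar) [slot ar 1 s 0] 1 (code (Node s ts))"
proof -
  let ?t = "Node s ts"
  define N where "N = internal_nodes ?t"
  define D where "D = dc ?t"
  define w where "w = concat (map code ts)"
  define A where "A = trav (address_push ar) (address_push ar 1 [] s) 2 w"
  define V where "V = trav (slot_push ar) (slot_push ar 1 (slot ar 1 s 0) s) 2 w"
  have N: "N = [] # A"
    using trav_code[OF t, of "[]" 1] map_idI[of N "(@) []"] by (simp add: N_def A_def w_def numeral_2_eq_2)
  have D: "D = s # syms w"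
    by (simp add: D_def dc_eq_syms w_def)
  have "list_all2 (parent_edge ar N D) A V"
    unfolding A_def V_def
  proof (rule trav_parent_edge[where Npre = "[[]]" and Dpre = "[s]"])
    show "list_all2 (parent_edge ar N D) (address_push ar 1 [] s) (slot_push ar 1 (slot ar 1 s 0) s)"
      unfolding address_push_def slot_push_def
      by (auto simp: list_all2_conv_all_nth parent_edge_def N D simp del: upt_Suc intro!: exI[of _ 1])
  qed (simp_all add: N A_def D)
  then have V: "length V = length A" "\<And>i. i < length A \<Longrightarrow> parent_edge ar N D (A ! i) (V ! i)"
    by (auto simp: list_all2_conv_all_nth)
  have dist: "distinct N"
    by (simp add: N_def internal_nodes_def distinct_preorder)
  have deg: "deg ?t = length N" by (simp add: deg_def N_def)
  have edges: "(p, j, i) \<in> edges ?t \<longleftrightarrow>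
     (1 \<le> p \<and> p \<le> length N \<and> 1 \<le> i \<and> i \<le> length N \<and> N ! (i - 1) = N ! (p - 1) @ [j]) \<or>
     (p = 1 \<and> j = 0 \<and> i = 1)" for p j i
    using N by (auto simp: edges_def deg node_def N_def[symmetric])
  \<comment> \<open>The definite descriptions in \<open>pa\<close> and \<open>lp\<close> are
    evaluated by exhibiting the only edge ending in \<open>i\<close>.\<close>
  have unique: "pa ?t i = p \<and> lp ?t i = j"
    if "(p, j, i) \<in> edges ?t" "\<And>p' j'. (p', j', i) \<in> edges ?t \<Longrightarrow> p' = p \<and> j' = j" for p j i
    using that unfolding pa_def lp_def by (intro conjI the_equality) blast+
  have rhs: "trav (slot_push ar) [slot ar 1 s 0] 1 (code ?t) = slot ar 1 s 0 # V"
    by (simp add: V_def w_def numeral_2_eq_2)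
  show ?thesis
  proof (rule nth_equalityI)
    show "length (cnc ar ?t) = length (trav (slot_push ar) [slot ar 1 s 0] 1 (code ?t))"
      unfolding rhs by (simp add: cnc_def deg N V(1) del: upt_Suc)
  next
    fix i assume "i < length (cnc ar ?t)"
    then have i: "i < length N" by (simp add: cnc_def deg del: upt_Suc)
    have lhs: "cnc ar ?t ! i = slot ar (pa ?t (Suc i)) (D ! (pa ?t (Suc i) - 1)) (lp ?t (Suc i))"
      using i by (simp add: cnc_def deg slot_def D_def del: upt_Suc)
    show "cnc ar ?t ! i = trav (slot_push ar) [slot ar 1 s 0] 1 (code ?t) ! i"
    proof (cases i)
      case 0
      \<comment> \<open>The root address \<open>[]\<close> extends no address, so only the
        conventional edge ends there.\<close>
      have "pa ?t 1 = 1 \<and> lp ?t 1 = 0"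
        by (rule unique) (auto simp: edges N)
      with 0 show ?thesis unfolding lhs rhs by (simp add: D)
    next
      case (Suc l)
      with i N V(2)[of l] obtain p j where pj: "1 \<le> p" "p \<le> length N" "N ! i = N ! (p - 1) @ [j]"
        "V ! l = slot ar p (D ! (p - 1)) j" by (auto simp: parent_edge_def)
      have "pa ?t (Suc i) = p \<and> lp ?t (Suc i) = j"
      proof (rule unique)
        show "(p, j, Suc i) \<in> edges ?t" using pj i by (simp add: edges)
      next
        fix p' j' assume "(p', j', Suc i) \<in> edges ?t"
        with Suc have p': "1 \<le> p'" "p' \<le> length N" "N ! i = N ! (p' - 1) @ [j']"
          by (auto simp: edges)
        \<comment> \<open>The last child number yields \<open>j\<close>; distinctness of the
          addresses then yields \<open>p\<close>.\<close>
        with pj have "N ! (p' - 1) = N ! (p - 1)" "j' = j" by simp_all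
        with dist p' pj have "p' - 1 = p - 1"
          by (subst (asm) nth_eq_iff_index_eq) auto
        with p' pj \<open>j' = j\<close> show "p' = p \<and> j' = j" by simp
      qed
      with Suc pj show ?thesis unfolding lhs rhs by simp
    qed
  qed
qed

section \<open>Monotonicity of the stack of connection values\<close>

text \<open>The bound spares the top because the initial stack of a nonleaf term holds the root
  label, which is at least 1 while \<open>m = 1\<close>.\<close>

definition decreasing_stack :: "nat \<Rightarrow> rat list \<Rightarrow> bool" where
  "decreasing_stack m st \<longleftrightarrow> sorted_wrt (>) st \<and> (\<forall>x\<in>set (tl st). x < of_nat m)"

lemma slot_bounds:
  assumes "j \<le> ar s"
  shows "of_nat m \<le> slot ar m s j" "slot ar m s j < of_nat (Suc m)"
proof -
  have "(2::rat) powi (int j - int (ar s)) \<le> 2 powi 0"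
    using assms by (intro power_int_increasing) auto
  then show "of_nat m \<le> slot ar m s j" by (simp add: slot_def)
  show "slot ar m s j < of_nat (Suc m)" by (simp add: slot_def)
qed

lemma slot_strict_antimono: "j < j' \<Longrightarrow> slot ar m s j' < slot ar m s j"
  by (simp add: slot_def power_int_strict_increasing)

lemma decreasing_stack_pop: "decreasing_stack m (q # st) \<Longrightarrow> decreasing_stack m st"
  by (cases st) (auto simp: decreasing_stack_def)

text \<open>The slots of node \<open>m\<close> are at least \<open>m\<close> and less than
  \<open>m + 1\<close>, hence above all remaining slots, and they decrease from the first child to
  the last.\<close>

lemma decreasing_stack_push:
  assumes "decreasing_stack m (q # st)"
  shows "decreasing_stack (Suc m) (slot_push ar m q s @ st)"
proof -
  have "sorted_wrt (>) (slot_push ar m q s)"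
    unfolding slot_push_def sorted_wrt_map
    by (rule sorted_wrt_mono_rel[of _ "(<)"]) (auto simp: slot_strict_antimono simp del: upt_Suc)
  moreover have "of_nat m \<le> x \<and> x < of_nat (Suc m)" if "x \<in> set (slot_push ar m q s)" for x
    using that slot_bounds[of _ ar s m] by (auto simp: slot_push_def simp del: upt_Suc of_nat_Suc)
  moreover have "x < of_nat m" if "x \<in> set st" for x
    using assms that by (simp add: decreasing_stack_def)
  moreover have "x < of_nat (Suc m)" if "x < of_nat m" for x :: rat
    using that by simp
  moreover have "set (tl xs) \<subseteq> set xs" for xs :: "rat list"
    by (cases xs) auto
  ultimately have "\<forall>x\<in>set (tl (slot_push ar m q s @ st)). x < of_nat (Suc m)"
    "\<forall>x\<in>set (slot_push ar m q s). \<forall>z\<in>set st. z < x" "sorted_wrt (>) (slot_push ar m q s)"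
    by (metis Un_iff set_append subsetD, metis less_le_trans, blast)
  then show ?thesis
    using assms by (simp add: decreasing_stack_def sorted_wrt_append)
qed

lemma decreasing_stack_top: "decreasing_stack m (q # st) \<Longrightarrow> x \<in> set st \<Longrightarrow> x < q"
  by (simp add: decreasing_stack_def)

lemma decreasing_stack_stk:
  "decreasing_stack m st \<Longrightarrow>
    decreasing_stack (m + length (syms u)) (stk (slot_push ar) st m u)"
proof (induction u arbitrary: st m)
  case (Cons x u)
  show ?case
  proof (cases st)
    case st: (Cons q st')
    show ?thesis
    proof (cases x)
      case None
      then show ?thesis using Cons.IH[of m st'] Cons.prems st decreasing_stack_pop[of m q st'] by simp
    next
      case (Some s)
      then show ?thesis using Cons.IH[of "Suc m" "slot_push ar m q s @ st'"]
          Cons.prems st decreasing_stack_push[of m q st' ar s] by simp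
    qed
  qed (simp add: decreasing_stack_def)
qed simp

section \<open>Comparison of words with the same symbols\<close>

text \<open>Only leaves precede the first symbol, and leaves open no slots.\<close>

lemma trav_first_mem:
  assumes "valid ar (length st) w" "syms w \<noteq> []"
  shows "trav push st m w ! 0 \<in> set st"
  using assms
proof (induction w arbitrary: st)
  case (Cons x w)
  then show ?case by (cases st; cases x) auto
qed simp

lemma stk_leaves:
  assumes "syms u = []"
  shows "set (stk push st m u) \<subseteq> set st"
  using assms
proof (induction u arbitrary: st)
  case (Cons x u)
  then show ?case by (cases st; cases x) auto
qed simp

lemma valid_None_iff: "valid ar n (None # w) \<longleftrightarrow> (\<exists>n'. n = Suc n' \<and> valid ar n' w)"
  by (cases n) auto

lemma valid_Some_iff: "valid ar n (Some s # w) \<longleftrightarrow> (\<exists>n'. n = Suc n' \<and> valid ar (ar s + n') w)"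
  by (cases n) auto

text \<open>Along a common prefix \<open>u\<close> of letters the stacks coincide, so the next letter of the
  connection word must be one of the open slots, and the two topmost ones are consecutive.\<close>

lemma no_slot_between:
  assumes "valid ar (length st) (u @ None # Some s # y)" "valid ar (length st) w"
    and "syms w = syms (u @ Some s # y)" "decreasing_stack m st"
    and "\<forall>j<length (syms u). trav (slot_push ar) st m w ! j =
           trav (slot_push ar) st m (u @ None # Some s # y) ! j"
  shows "trav (slot_push ar) st m w ! length (syms u) \<le>
           trav (slot_push ar) st m (u @ None # Some s # y) ! length (syms u) \<or>
         hd (stk (slot_push ar) st m u) \<le> trav (slot_push ar) st m w ! length (syms u)"
  using assms
proof (induction u arbitrary: st m w)
  case Nil
  then obtain x y' st' where st: "st = x # y' # st'"
    by (auto simp: valid_None_iff valid_Some_iff length_Suc_conv)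
  obtain b w' where w: "w = b # w'" using Nil by (cases w) auto
  show ?case
  proof (cases b)
    case None
    \<comment> \<open>If \<open>w\<close> also reads a leaf here, its next node lies in
      \<open>y'\<close> or lower; otherwise it takes the top slot \<open>x\<close>.\<close>
    with Nil.prems st w have "trav (slot_push ar) (y' # st') m w' ! 0 \<in> set (y' # st')"
      by (intro trav_first_mem[of ar]) auto
    moreover have "\<forall>z\<in>set (y' # st'). z \<le> y'"
      using Nil.prems(4) st by (auto simp: decreasing_stack_def)
    ultimately show ?thesis using st w None by auto
  next
    case (Some a)
    with st w show ?thesis by simp
  qed
next
  case (Cons c u)
  from Cons.prems obtain q st' where st: "st = q # st'" by (cases st) auto
  obtain b w' where w: "w = b # w'" using Cons.prems by (cases w; cases c) auto
  note pop = decreasing_stack_pop[OF Cons.prems(4)[unfolded st]]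
  note top = decreasing_stack_top[OF Cons.prems(4)[unfolded st]]
  show ?case
  proof (cases c)
    case c: None
    show ?thesis
    proof (cases b)
      case None
      then show ?thesis using Cons.IH[of st' w' m] Cons.prems st w c pop by simp
    next
      case b: (Some a)
      show ?thesis
      \<comment> \<open>Here \<open>w\<close> fills \<open>q\<close> while the other word closes it.
        If \<open>u\<close> has no symbols, this is the entry in question, and \<open>q\<close>
        exceeds every remaining slot; otherwise the first entries would already differ.\<close>
      proof (cases "syms u = []")
        case True
        have "valid ar (length (stk (slot_push ar) st' m u)) (None # Some s # y)"
          using Cons.prems st c by (intro valid_stk) auto
        then have "hd (stk (slot_push ar) st' m u) \<in> set st'"
          using stk_leaves[OF True, of "slot_push ar" st' m]
          by (cases "stk (slot_push ar) st' m u") auto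
        then show ?thesis using top b c w st True by (auto intro: less_imp_le)
      next
        case False
        have "trav (slot_push ar) st' m (u @ None # Some s # y) ! 0 \<in> set st'"
          using Cons.prems st c False by (intro trav_first_mem[of ar]) auto
        moreover have "trav (slot_push ar) st' m (u @ None # Some s # y) ! 0 = q"
          using Cons.prems(5)[rule_format, of 0] False st w b c by simp
        ultimately show ?thesis using top by force
      qed
    qed
  next
    case c: (Some a)
    show ?thesis
    proof (cases b)
      case None
      \<comment> \<open>After closing \<open>q\<close>, \<open>w\<close> puts its next node strictly
        lower, against the agreement at index 0.\<close>
      have "trav (slot_push ar) st' m w' ! 0 \<in> set st'"
        using Cons.prems st c w None by (intro trav_first_mem[of ar]) auto
      moreover have "trav (slot_push ar) st' m w' ! 0 = q"
        using Cons.prems(5)[rule_format, of 0] st w None c by simp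
      ultimately show ?thesis using top by force
    next
      case b: (Some a')
      with Cons.prems c w have "a' = a" by simp
      moreover have "\<forall>j<length (syms u).
         trav (slot_push ar) (slot_push ar m q a @ st') (Suc m) w' ! j =
         trav (slot_push ar) (slot_push ar m q a @ st') (Suc m) (u @ None # Some s # y) ! j"
      proof (intro allI impI)
        fix j assume "j < length (syms u)"
        then show "trav (slot_push ar) (slot_push ar m q a @ st') (Suc m) w' ! j =
          trav (slot_push ar) (slot_push ar m q a @ st') (Suc m) (u @ None # Some s # y) ! j"
          using Cons.prems(5)[rule_format, of "Suc j"] c b w st \<open>a' = a\<close> by simp
      qed
      moreover have "decreasing_stack (Suc m) (slot_push ar m q a @ st')"
        using Cons.prems(4) st by (intro decreasing_stack_push) simp
      ultimately show ?thesis
        using Cons.IH[of "slot_push ar m q a @ st'" w' "Suc m"] Cons.prems(1-3) st w c b by simp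
    qed
  qed
qed

lemma leaves_before_symbol:
  "syms (None # w) = a # v \<Longrightarrow> \<exists>u y. None # w = u @ None # Some a # y \<and> syms u = []"
proof (induction w)
  case (Cons x w)
  show ?case
  proof (cases x)
    case None
    with Cons obtain u y where "None # w = u @ None # Some a # y" "syms u = []" by auto
    with None show ?thesis by (intro exI[of _ "None # u"] exI[of _ y]) simp
  next
    case (Some b)
    with Cons.prems show ?thesis by (intro exI[of _ "[]"] exI[of _ w]) simp
  qed
qed simp

text \<open>The step is taken at the first node whose parent edges differ: the stacks coincide there,
  so the larger word takes a higher slot and the smaller one closes at least one leaf first.\<close>

lemma step_below:
  assumes "valid ar (length st) w1" "valid ar (length st) w2" "syms w1 = syms w2"
    and "decreasing_stack m st"
    and "list_all2 (\<le>) (trav (slot_push ar) st m w1) (trav (slot_push ar) st m w2)"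
    and "w1 \<noteq> w2"
  shows "\<exists>u s y. w1 = u @ None # Some s # y \<and>
    hd (stk (slot_push ar) st m u) \<le> trav (slot_push ar) st m w2 ! length (syms u)"
  using assms
proof (induction w1 arbitrary: st m w2)
  case Nil
  then show ?case by simp
next
  case (Cons c w1)
  from Cons.prems obtain q st' where st: "st = q # st'" by (cases st) auto
  obtain b w' where w: "w2 = b # w'" using Cons.prems st by (cases w2) auto
  note pop = decreasing_stack_pop[OF Cons.prems(4)[unfolded st]]
  note top = decreasing_stack_top[OF Cons.prems(4)[unfolded st]]
  show ?case
  proof (cases c)
    case c: None
    show ?thesis
    proof (cases b)
      case None
      then obtain u s y where "w1 = u @ None # Some s # y"
        "hd (stk (slot_push ar) st' m u) \<le> trav (slot_push ar) st' m w' ! length (syms u)"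
        using Cons.IH[of st' w' m] Cons.prems st w c pop by auto
      then show ?thesis using c None st w by (intro exI[of _ "None # u"]) auto
    next
      case b: (Some a)
      \<comment> \<open>The second word fills \<open>q\<close> at once. The last leaf before the
        next symbol of the first word provides the step, into a slot that is at most
        \<open>q\<close>.\<close>
      then obtain u y where u: "None # w1 = u @ None # Some a # y" "syms u = []"
        using leaves_before_symbol[of w1 a "syms w'"] Cons.prems(3) c w by auto
      have "valid ar (length (stk (slot_push ar) st m u)) (None # Some a # y)"
        using Cons.prems(1) c u by (intro valid_stk) auto
      then have "hd (stk (slot_push ar) st m u) \<in> set st"
        using stk_leaves[OF u(2), of "slot_push ar" st m]
        by (cases "stk (slot_push ar) st m u") auto
      then show ?thesis using u top st w b c
        by (intro exI[of _ u] exI[of _ a] exI[of _ y]) (auto intro: less_imp_le)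
    qed
  next
    case c: (Some a)
    show ?thesis
    proof (cases b)
      case None
      \<comment> \<open>Excluded by the order: the first word fills \<open>q\<close>, while the
        second closes it and goes strictly lower.\<close>
      have "trav (slot_push ar) st' m w' ! 0 \<in> set st'"
        using Cons.prems st c w None by (intro trav_first_mem[of ar]) auto
      moreover have "q \<le> trav (slot_push ar) st' m w' ! 0"
        using Cons.prems(5) st w None c by (auto simp: list_all2_Cons1)
      ultimately show ?thesis using top by force
    next
      case b: (Some a')
      with Cons.prems c w have "a' = a" by simp
      moreover have "decreasing_stack (Suc m) (slot_push ar m q a @ st')"
        using Cons.prems(4) st by (intro decreasing_stack_push) simp
      ultimately obtain u s y where "w1 = u @ None # Some s # y"
        "hd (stk (slot_push ar) (slot_push ar m q a @ st') (Suc m) u) \<le>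
         trav (slot_push ar) (slot_push ar m q a @ st') (Suc m) w' ! length (syms u)"
        using Cons.IH[of "slot_push ar m q a @ st'" w' "Suc m"] Cons.prems st w c b by auto
      then show ?thesis using c b st w \<open>a' = a\<close> by (intro exI[of _ "c # u"]) auto
    qed
  qed
qed

text \<open>Let \<open>x # y # st'\<close> be the stack after \<open>u\<close>. Before the move the
  leaf closes \<open>x\<close> and the node takes \<open>y\<close>; afterwards the node takes
  \<open>x\<close> and the leaf closes \<open>y\<close>. In both cases \<open>v\<close> runs on its
  own slots and \<open>z\<close> starts from \<open>st'\<close>, so a single entry changes, from
  \<open>y\<close> to \<open>x\<close>.\<close>

lemma trav_step:
  assumes "valid ar (length st) (u @ None # (Some s # v) @ z)" "valid ar (ar s) v"
    and "decreasing_stack m st"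
  defines "R \<equiv> trav (slot_push ar) st m (u @ None # (Some s # v) @ z)"
    and "x \<equiv> hd (stk (slot_push ar) st m u)"
  shows "trav (slot_push ar) st m (u @ (Some s # v) @ None # z) = R[length (syms u) := x]"
    and "R ! length (syms u) < x" and "length (syms u) < length R"
proof -
  have "valid ar (length (stk (slot_push ar) st m u)) (None # (Some s # v) @ z)"
    using assms(1) by (intro valid_stk) auto
  \<comment> \<open>Two slots must be open, one for the leaf and one for the node.\<close>
  then obtain y st' where st: "stk (slot_push ar) st m u = x # y # st'"
    by (cases "stk (slot_push ar) st m u"; cases "tl (stk (slot_push ar) st m u)")
      (auto simp: x_def valid_Some_iff)
  let ?m = "m + length (syms u)"
  have len: "length (trav (slot_push ar) st m u) = length (syms u)"
    using assms(1) by (intro length_trav) auto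
  have v: "trav (slot_push ar) (slot_push ar k q s @ st'') k' (v @ w) =
    trav (slot_push ar) (slot_push ar k q s) k' v @
    trav (slot_push ar) st'' (k' + length (syms v)) w" for k q st'' k' w
    using assms(2) by (intro trav_valid_append) auto
  \<comment> \<open>Slot values depend on the number and decoration of the parent, not on where it
    hangs, so the entries inside the moved subterm persist.\<close>
  have push: "slot_push ar ?m x s = slot_push ar ?m y s"
    by (simp add: slot_push_def)
  have R: "R = trav (slot_push ar) st m u @ y # trav (slot_push ar) (slot_push ar ?m y s) (Suc ?m) v @
      trav (slot_push ar) st' (Suc ?m + length (syms v)) z"
    by (simp add: R_def trav_append[of _ st] st v)
  show "trav (slot_push ar) st m (u @ (Some s # v) @ None # z) = R[length (syms u) := x]"
    unfolding R by (simp add: trav_append[of _ st] st v push list_update_append len)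
  show "length (syms u) < length R" unfolding R by (simp add: len)
  have "y < x"
    using decreasing_stack_stk[OF assms(3), of u ar] st by (simp add: decreasing_stack_def)
  then show "R ! length (syms u) < x" unfolding R by (simp add: nth_append len)
qed

section \<open>Wind steps and the order on terms\<close>

text \<open>The 0 for \<open>Leaf\<close> is a placeholder that the leaf letter pops without output;
  it keeps the stack at height 1, as \<open>valid ar 1\<close> demands.\<close>

definition root_slot :: "('s \<Rightarrow> nat) \<Rightarrow> 's trm \<Rightarrow> rat list" where
  "root_slot ar t = [case t of Leaf \<Rightarrow> 0 | Node s ts \<Rightarrow> slot ar 1 s 0]"

lemma root_slot_props [simp]:
  "length (root_slot ar t) = 1" "decreasing_stack m (root_slot ar t)"
  by (simp_all add: root_slot_def decreasing_stack_def)

lemma root_slot_cong: "dc t1 = dc t2 \<Longrightarrow> root_slot ar t1 = root_slot ar t2"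
  by (cases t1; cases t2) (simp_all add: root_slot_def dc_eq_syms)

lemma cnc_eq:
  "t \<in> terms S ar \<Longrightarrow> cnc ar t = trav (slot_push ar) (root_slot ar t) 1 (code t)"
proof (cases t)
  case Leaf
  then show ?thesis by (simp add: root_slot_def cnc_def deg_eq dc_eq_syms)
qed (simp only: cnc_eq_trav root_slot_def trm.case)

lemma length_cnc: "length (cnc ar t) = deg t"
  by (simp add: cnc_def)

lemma wind_le_iff:
  "wind_le ar t1 t2 \<longleftrightarrow> dc t1 = dc t2 \<and> list_all2 (\<le>) (cnc ar t1) (cnc ar t2)"
proof -
  have "(\<forall>i\<in>{1..n}. P (i - 1)) \<longleftrightarrow> (\<forall>i<n. P i)" for n and P :: "nat \<Rightarrow> bool"
    by (metis One_nat_def Suc_le_eq Suc_le_mono Suc_pred atLeastAtMost_iff diff_Suc_1 le0)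
  from this[of "deg t1" "\<lambda>i. cnc ar t1 ! i \<le> cnc ar t2 ! i"] show ?thesis
    by (auto simp: wind_le_def list_all2_conv_all_nth length_cnc deg_eq)
qed

text \<open>On words, a step exchanges the leaf letter at position \<open>k\<close> with the code of
  the subterm that follows it.\<close>

lemma wind_step_word:
  assumes t1: "t1 \<in> terms S ar" and k: "Suc k < length (code t1)"
    and k0: "code t1 ! k = None" and k1: "code t1 ! Suc k = Some s"
    and t2: "t2 = replace_at (replace_at t1 (preorder t1 ! Suc k) Leaf)
                    (preorder t1 ! k) (subterm_at t1 (preorder t1 ! Suc k))"
  obtains v z where "code t1 = take k (code t1) @ None # (Some s # v) @ z"
    "valid ar (ar s) v" "code t2 = take k (code t1) @ (Some s # v) @ None # z" "t2 \<in> terms S ar"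
proof -
  let ?p = "preorder t1 ! Suc k"
  let ?t = "replace_at t1 ?p Leaf"
  let ?u = "subterm_at t1 ?p"
  define C where "C = take k (code t1)"
  obtain z where z: "code t1 = take (Suc k) (code t1) @ code ?u @ z"
    "\<And>r. code (replace_at t1 ?p r) = take (Suc k) (code t1) @ code r @ z"
    "\<And>r. take (Suc (Suc k)) (preorder (replace_at t1 ?p r)) = take (Suc (Suc k)) (preorder t1)"
    using code_split[OF k] by blast
  have u: "?u \<in> terms S ar" and t: "?t \<in> terms S ar"
    using subterm_replace_terms[OF t1, of ?p] k terms.Leaf[of S ar] by simp_all
  have "letter ?u = Some s"
    using k k1 by (simp add: nth_code)
  then obtain ts where ts: "?u = Node s ts"
    by (auto simp: letter_def split: trm.splits)
  have v: "valid ar (ar s) (concat (map code ts))"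
    using valid_code[OF u] unfolding ts by simp
  have lenC: "length C = k" using k by (simp add: C_def)
  have tk: "take (Suc k) (code t1) = C @ [None]"
    using k k0 by (simp add: C_def take_Suc_conv_app_nth)
  \<comment> \<open>The first \<open>None\<close> is the leaf at position \<open>k\<close>, the
    second the leaf left behind by the detached subterm.\<close>
  have codet: "code ?t = C @ None # None # z"
    using z(2)[of Leaf] unfolding tk by simp
  have lt: "k < length (code ?t)" unfolding codet by (simp add: lenC)
  have q: "preorder ?t ! k = preorder t1 ! k"
    using arg_cong[OF z(3)[of Leaf], of "\<lambda>x. x ! k"] by simp
  have tkt: "take k (code ?t) = C" "code ?t ! k = None"
    unfolding codet by (simp_all add: lenC nth_append)
  have "subterm_at ?t (preorder ?t ! k) = Leaf"
    using lt tkt(2) by (simp add: nth_code)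
  moreover obtain z' where "code ?t = C @ code (subterm_at ?t (preorder ?t ! k)) @ z'"
    and z': "code t2 = C @ code ?u @ z'"
    using code_split[OF lt] unfolding t2 q tkt(1) by blast
  ultimately have "code ?t = C @ None # z'" by simp
  then have "z' = None # z" unfolding codet by simp
  moreover have "t2 \<in> terms S ar"
    unfolding t2 using subterm_replace_terms(2)[OF t, of "preorder t1 ! k"] u lt q
    by (metis length_preorder nth_mem)
  moreover have "code t1 = C @ None # (Some s # concat (map code ts)) @ z"
    by (subst z(1)) (simp add: tk ts)
  ultimately show ?thesis
    using that[folded C_def] z' v ts by simp
qed

text \<open>Passes from node numbers to word positions: an address in preorder is that of an
  internal node exactly when its letter is a symbol.\<close>

lemma wind_step_iff:
  "wind_step t1 t2 \<longleftrightarrow> (\<exists>k s. Suc k < length (code t1) \<and> code t1 ! k = None \<and> code t1 ! Suc k = Some s \<and>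
     t2 = replace_at (replace_at t1 (preorder t1 ! Suc k) Leaf)
            (preorder t1 ! k) (subterm_at t1 (preorder t1 ! Suc k)))"
    (is "_ \<longleftrightarrow> ?rhs")
proof
  assume "wind_step t1 t2"
  then obtain i k where i: "i \<ge> 1" "i \<le> deg t1" and k: "Suc k < length (preorder t1)"
    "preorder t1 ! Suc k = node t1 i" "subterm_at t1 (preorder t1 ! k) = Leaf"
    "t2 = replace_at (replace_at t1 (node t1 i) Leaf) (preorder t1 ! k) (subterm_at t1 (node t1 i))"
    by (auto simp: wind_step_def wind_step_at_def)
  from i have "node t1 i \<in> set (internal_nodes t1)"
    by (simp add: node_def deg_def)
  then have "letter (subterm_at t1 (preorder t1 ! Suc k)) \<noteq> None"
    by (simp add: k(2) internal_nodes_def)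
  then obtain s where "letter (subterm_at t1 (preorder t1 ! Suc k)) = Some s" by blast
  moreover have "letter (subterm_at t1 (preorder t1 ! k)) = None" by (simp add: k(3))
  ultimately show ?rhs
    using k by (intro exI[of _ k] exI[of _ s]) (simp add: nth_code)
next
  assume ?rhs
  then obtain k s where k: "Suc k < length (preorder t1)" "letter (subterm_at t1 (preorder t1 ! k)) = None"
    "letter (subterm_at t1 (preorder t1 ! Suc k)) = Some s"
    "t2 = replace_at (replace_at t1 (preorder t1 ! Suc k) Leaf)
            (preorder t1 ! k) (subterm_at t1 (preorder t1 ! Suc k))"
    by (auto simp: nth_code)
  then have "subterm_at t1 (preorder t1 ! Suc k) \<noteq> Leaf"
    by (metis letter_simps(1) option.distinct(1))
  then have "preorder t1 ! Suc k \<in> set (internal_nodes t1)"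
    using k(1) by (simp add: internal_nodes_def)
  then obtain i where "i < deg t1" "preorder t1 ! Suc k = node t1 (Suc i)"
    by (auto simp: in_set_conv_nth deg_def node_def)
  with k show "wind_step t1 t2"
    unfolding wind_step_def wind_step_at_def
    by (intro exI[of _ "Suc i"]) (auto intro!: exI[of _ k])
qed

lemma wind_step_cnc:
  assumes t1: "t1 \<in> terms S ar" and k: "Suc k < length (code t1)"
    and k0: "code t1 ! k = None" and k1: "code t1 ! Suc k = Some s"
    and t2: "t2 = replace_at (replace_at t1 (preorder t1 ! Suc k) Leaf)
                    (preorder t1 ! k) (subterm_at t1 (preorder t1 ! Suc k))"
  defines "n \<equiv> length (syms (take k (code t1)))"
    and "x \<equiv> hd (stk (slot_push ar) (root_slot ar t1) 1 (take k (code t1)))"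
  shows "t2 \<in> terms S ar" "dc t2 = dc t1" "cnc ar t2 = (cnc ar t1)[n := x]"
    "cnc ar t1 ! n < x" "n < length (cnc ar t1)"
proof -
  obtain v z where v: "code t1 = take k (code t1) @ None # (Some s # v) @ z"
    "valid ar (ar s) v" "code t2 = take k (code t1) @ (Some s # v) @ None # z" "t2 \<in> terms S ar"
    using wind_step_word[OF t1 k k0 k1 t2] .
  show "t2 \<in> terms S ar" by fact
  show dc: "dc t2 = dc t1"
    unfolding dc_eq_syms v(3) by (subst (2) v(1)) simp
  have val: "valid ar (length (root_slot ar t1)) (take k (code t1) @ None # (Some s # v) @ z)"
    using valid_code[OF t1] v(1) by simp
  note step = trav_step[OF val v(2) root_slot_props(2), of 1, folded v(1), folded v(3)]
  show "cnc ar t2 = (cnc ar t1)[n := x]" "cnc ar t1 ! n < x" "n < length (cnc ar t1)"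
    using step unfolding cnc_eq[OF t1] cnc_eq[OF v(4)] root_slot_cong[OF dc] n_def x_def by simp_all
qed

text \<open>The step raises one entry, to a slot not exceeding the entry of \<open>t2\<close>, and
  keeps all others. That the connection words differ is recorded because it yields their injectivity
  below.\<close>

lemma exists_wind_step_below:
  assumes t1: "t1 \<in> terms S ar" and t2: "t2 \<in> terms S ar" and le: "wind_le ar t1 t2" and ne: "t1 \<noteq> t2"
  shows "\<exists>t3\<in>terms S ar. wind_step t1 t3 \<and> wind_less ar t1 t3 \<and>
    cnc ar t1 \<noteq> cnc ar t3 \<and> wind_le ar t3 t2"
proof -
  have dc: "dc t1 = dc t2" and le': "list_all2 (\<le>) (cnc ar t1) (cnc ar t2)"
    using le by (auto simp: wind_le_iff)
  have "code t1 \<noteq> code t2" using code_inj t1 t2 ne by blast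
  then obtain u s y where u: "code t1 = u @ None # Some s # y"
    and x: "hd (stk (slot_push ar) (root_slot ar t1) 1 u) \<le> cnc ar t2 ! length (syms u)"
    using step_below[of ar "root_slot ar t1" "code t1" "code t2" 1] valid_code[OF t1] valid_code[OF t2]
      dc le' cnc_eq[OF t1] cnc_eq[OF t2] root_slot_cong[OF dc]
    by (auto simp: dc_eq_syms)
  let ?k = "length u"
  define t3 where "t3 = replace_at (replace_at t1 (preorder t1 ! Suc ?k) Leaf)
                    (preorder t1 ! ?k) (subterm_at t1 (preorder t1 ! Suc ?k))"
  have k: "Suc ?k < length (code t1)" "code t1 ! ?k = None" "code t1 ! Suc ?k = Some s"
    "take ?k (code t1) = u"
    by (simp_all add: u nth_append)
  note step = wind_step_cnc[OF t1 k(1-3) t3_def, unfolded k(4)]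
  have "wind_step t1 t3"
    unfolding wind_step_iff using k t3_def by blast
  moreover have "wind_le ar t1 t3"
    using step by (auto simp: wind_le_iff list_all2_conv_all_nth nth_list_update)
  moreover have "cnc ar t1 \<noteq> cnc ar t3"
    using step(3-5) by (metis less_irrefl nth_list_update_eq)
  moreover have "wind_le ar t3 t2"
    using step x dc le' by (auto simp: wind_le_iff list_all2_conv_all_nth nth_list_update)
  ultimately show ?thesis using step(1) by (auto simp: wind_less_def)
qed

text \<open>Otherwise a step from \<open>t1\<close> would stay below \<open>t2\<close>; its
  connection word, squeezed between two equal words, could not change, yet a step strictly raises an
  entry.\<close>

lemma cnc_inj:
  assumes "t1 \<in> terms S ar" "t2 \<in> terms S ar" "dc t1 = dc t2" "cnc ar t1 = cnc ar t2"
  shows "t1 = t2"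
proof (rule ccontr)
  assume "t1 \<noteq> t2"
  moreover have "wind_le ar t1 t2" using assms by (simp add: wind_le_iff list_all2_refl)
  ultimately obtain t3 where "wind_le ar t1 t3" "wind_le ar t3 t2" "cnc ar t1 \<noteq> cnc ar t3"
    using exists_wind_step_below assms(1,2) unfolding wind_less_def by blast
  then show False
    using list_all2_antisym[of "(\<le>)" "(\<le>)" "cnc ar t1" "cnc ar t3"] assms(4)
    by (auto simp: wind_le_iff)
qed

theorem theorem2p2p9:
  fixes S :: "'s set" and ar :: "'s \<Rightarrow> nat" and t1 t2 :: "'s trm"
  assumes "t1 \<in> terms S ar" and "t2 \<in> terms S ar"
  shows "wind_step t1 t2 \<longleftrightarrow>
    wind_less ar t1 t2 \<and>
    \<not> (\<exists>t3\<in>terms S ar. wind_less ar t1 t3 \<and> wind_less ar t3 t2)"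
proof
  assume "wind_step t1 t2"
  then obtain k s where k: "Suc k < length (code t1)" "code t1 ! k = None" "code t1 ! Suc k = Some s"
    "t2 = replace_at (replace_at t1 (preorder t1 ! Suc k) Leaf)
            (preorder t1 ! k) (subterm_at t1 (preorder t1 ! Suc k))"
    by (auto simp: wind_step_iff)
  define u where "u = take k (code t1)"
  define n where "n = length (syms u)"
  define x where "x = hd (stk (slot_push ar) (root_slot ar t1) 1 u)"
  note step = wind_step_cnc[OF assms(1) k, folded u_def, folded n_def x_def]
  define y where "y = drop (Suc (Suc k)) (code t1)"
  have u: "code t1 = u @ None # Some s # y"
    using k(1-3) unfolding u_def y_def by (metis Cons_nth_drop_Suc Suc_lessD append_take_drop_id)
  have "cnc ar t1 \<noteq> cnc ar t2"
    using step(3-5) by (metis less_irrefl nth_list_update_eq)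
  then have "wind_less ar t1 t2"
    using step by (auto simp: wind_less_def wind_le_iff list_all2_conv_all_nth nth_list_update)
  moreover have False
    if t3: "t3 \<in> terms S ar" and less: "wind_less ar t1 t3" "wind_less ar t3 t2" for t3
  proof -
    have dc: "dc t3 = dc t1" and len: "length (cnc ar t3) = length (cnc ar t1)"
      and lower: "\<And>j. j < length (cnc ar t1) \<Longrightarrow> cnc ar t1 ! j \<le> cnc ar t3 ! j"
      and upper: "\<And>j. j < length (cnc ar t1) \<Longrightarrow> cnc ar t3 ! j \<le> (cnc ar t1)[n := x] ! j"
      using less step(3) by (auto simp: wind_less_def wind_le_iff list_all2_conv_all_nth)
    \<comment> \<open>Away from \<open>n\<close> the lower and upper bounds coincide.\<close>
    have eq: "cnc ar t3 ! j = cnc ar t1 ! j" if "j < length (cnc ar t1)" "j \<noteq> n" for j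
      using lower[of j] upper[of j] that by simp
    \<comment> \<open>The entries of \<open>t1\<close> and \<open>t2\<close> at \<open>n\<close> are
      consecutive slots of the stack, and \<open>t3\<close> agrees with \<open>t1\<close> before
      \<open>n\<close>.\<close>
    have "cnc ar t3 ! n \<le> cnc ar t1 ! n \<or> x \<le> cnc ar t3 ! n"
    proof -
      have "syms (code t3) = syms (u @ Some s # y)"
        using dc unfolding dc_eq_syms by (simp add: u)
      moreover have "\<forall>j<n. cnc ar t3 ! j = cnc ar t1 ! j"
        using eq step(5) by simp
      ultimately show ?thesis
        using no_slot_between[of ar "root_slot ar t1" u s y "code t3" 1,
            folded u] valid_code[OF assms(1)] valid_code[OF t3]
          cnc_eq[OF assms(1)] cnc_eq[OF t3] root_slot_cong[OF dc, of ar]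
        by (simp add: n_def x_def)
    qed
    then have "cnc ar t3 ! n = cnc ar t1 ! n \<or> cnc ar t3 ! n = x"
      using lower[OF step(5)] upper[OF step(5)] step(5) by auto
    then have "cnc ar t3 = cnc ar t1 \<or> cnc ar t3 = cnc ar t2"
    proof
      assume n: "cnc ar t3 ! n = cnc ar t1 ! n"
      have "cnc ar t3 = cnc ar t1"
        by (rule nth_equalityI[OF len]) (use n eq len in metis)
      then show ?thesis ..
    next
      assume n: "cnc ar t3 ! n = x"
      have "cnc ar t3 = cnc ar t2"
      proof (rule nth_equalityI)
        fix i assume "i < length (cnc ar t3)"
        then show "cnc ar t3 ! i = cnc ar t2 ! i"
          unfolding step(3) by (cases "i = n") (simp_all add: n eq len)
      qed (simp add: step(3) len)
      then show ?thesis ..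
    qed
    then show False
      using cnc_inj[OF t3 assms(1) dc] cnc_inj[OF t3 assms(2)] dc step(2) less
      by (auto simp: wind_less_def)
  qed
  ultimately show "wind_less ar t1 t2 \<and>
    \<not> (\<exists>t3\<in>terms S ar. wind_less ar t1 t3 \<and> wind_less ar t3 t2)"
    by blast
next
  assume cover: "wind_less ar t1 t2 \<and>
    \<not> (\<exists>t3\<in>terms S ar. wind_less ar t1 t3 \<and> wind_less ar t3 t2)"
  then have "wind_less ar t1 t2" ..
  then have "wind_le ar t1 t2" "t1 \<noteq> t2"
    by (simp_all add: wind_less_def)
  then obtain t3 where t3: "t3 \<in> terms S ar" "wind_step t1 t3" "wind_less ar t1 t3" "wind_le ar t3 t2"
    using exists_wind_step_below[OF assms] by blast
  \<comment> \<open>As \<open>t3\<close> lies below \<open>t2\<close>, but not strictly, the two are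
    equal and the step found is the required one.\<close>
  with cover have "\<not> wind_less ar t3 t2" by blast
  with t3 show "wind_step t1 t2"
    by (simp add: wind_less_def)
qed

end
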